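(* Let $\mu,\nu>0$ and let $M,K$ be positive integers with $M\le K$. The steady-state distribution of the Markov process $\{Z_f(t),t\ge0\}$, the birth-death process on $\{0,\dots,K\}$ with birth rate $\nu(K-z)$ and death rate $\mu\min\{z,M\}$ in state $z$, is given by $$\pi_f(z)=\begin{cases}\Big(\dfrac{\mu}{\nu}\Big)^{M-z}\dfrac{\prod_{j=0}^{M-z-1}(M-j)}{\prod_{j=1}^{M-z}(K-M+j)}\,\pi_f(M), & 0\le z<M,\\[3mm] \dfrac{1}{M^{z-M}}\Big(\dfrac{\nu}{\mu}\Big)^{z-M}\displaystyle\prod_{j=0}^{z-M-1}(K-M-j)\,\pi_f(M), & M\le z\le K,\end{cases}$$ where $$\pi_f(M)=\Big(\sum_{l=0}^{M-1}\Big(\frac{\mu}{\nu}\Big)^{M-l}\frac{\prod_{j=0}^{M-l-1}(M-j)}{\prod_{j=1}^{M-l}(K-M+j)}+\sum_{l=M}^{K}\frac{1}{M^{l-M}}\Big(\frac{\nu}{\mu}\Big)^{l-M}\prod_{j=0}^{l-M-1}(K-M-j)\Big)^{-1}.$$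
   Context: The process $Z_f$ models the number of uncharged vehicles in a parking lot with $K$ spaces that is always full: each departing vehicle (each vehicle departs at rate $\nu$) is immediately replaced by an uncharged one, and vehicles become fully charged at total rate $\mu\min\{z,M\}$ when $z$ are uncharged. Empty products equal 1. *)

theory Defs
  imports "HOL-Probability.Probability"
begin

definition transition_function :: "nat set \<Rightarrow> (real \<Rightarrow> nat \<Rightarrow> nat \<Rightarrow> real) \<Rightarrow> bool" where
  "transition_function S P \<longleftrightarrow>
     (\<forall>t\<ge>0. \<forall>i\<in>S. (\<forall>j\<in>S. 0 \<le> P t i j) \<and> (\<Sum>j\<in>S. P t i j) = 1) \<and>
     (\<forall>i\<in>S. \<forall>j\<in>S. P 0 i j = (if i = j then 1 else 0)) \<and>
     (\<forall>s\<ge>0. \<forall>t\<ge>0. \<forall>i\<in>S. \<forall>j\<in>S. P (s + t) i j = (\<Sum>k\<in>S. P s i k * P t k j))"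

text \<open>The infinitesimal description \<open>P h i j = \<delta>\<^sub>i\<^sub>j + Q i j * h + o(h)\<close> as \<open>h\<close> decreases to 0.\<close>

definition has_rates :: "nat set \<Rightarrow> (real \<Rightarrow> nat \<Rightarrow> nat \<Rightarrow> real) \<Rightarrow> (nat \<Rightarrow> nat \<Rightarrow> real) \<Rightarrow> bool" where
  "has_rates S P Q \<longleftrightarrow>
     (\<forall>i\<in>S. \<forall>j\<in>S. ((\<lambda>t. P t i j) has_real_derivative Q i j) (at 0 within {0..}))"

definition birth_death_generator :: "(nat \<Rightarrow> real) \<Rightarrow> (nat \<Rightarrow> real) \<Rightarrow> nat \<Rightarrow> nat \<Rightarrow> real" where
  "birth_death_generator birth death i j =
     (if j = i + 1 then birth i
      else if i = j + 1 then death i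
      else if i = j then - (birth i + death i)
      else 0)"

text \<open>The last conjunct is the time-homogeneous Markov property
  \<open>Pr(Z(t\<^sub>n\<^sub>+\<^sub>1) = x\<^sub>n\<^sub>+\<^sub>1 | Z(t\<^sub>k) = x\<^sub>k, k \<le> n) = P (t\<^sub>n\<^sub>+\<^sub>1 - t\<^sub>n) x\<^sub>n x\<^sub>n\<^sub>+\<^sub>1\<close>,
  multiplied by the probability of the conditioning event so that null events need no exception.
  The initial distribution is arbitrary.\<close>

definition markov_process ::
  "'w measure \<Rightarrow> (real \<Rightarrow> 'w \<Rightarrow> nat) \<Rightarrow> nat set \<Rightarrow> (real \<Rightarrow> nat \<Rightarrow> nat \<Rightarrow> real) \<Rightarrow> bool" where
  "markov_process \<Omega> Z S P \<longleftrightarrow>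
     prob_space \<Omega> \<and>
     transition_function S P \<and>
     (\<forall>t\<ge>0. Z t \<in> measurable \<Omega> (count_space S)) \<and>
     (\<forall>(n::nat) (t::nat \<Rightarrow> real) (x::nat \<Rightarrow> nat).
        0 \<le> t 0 \<longrightarrow> (\<forall>k\<le>n. t k < t (Suc k)) \<longrightarrow> (\<forall>k\<le>Suc n. x k \<in> S) \<longrightarrow>
        measure \<Omega> {\<omega> \<in> space \<Omega>. \<forall>k\<le>Suc n. Z (t k) \<omega> = x k} =
        measure \<Omega> {\<omega> \<in> space \<Omega>. \<forall>k\<le>n. Z (t k) \<omega> = x k}
          * P (t (Suc n) - t n) (x n) (x (Suc n)))"

text \<open>On \<open>{0..K}\<close> it is understood that \<open>birth K = 0\<close> and \<open>death 0 = 0\<close>.\<close>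

definition birth_death_process ::
  "'w measure \<Rightarrow> (real \<Rightarrow> 'w \<Rightarrow> nat) \<Rightarrow> (real \<Rightarrow> nat \<Rightarrow> nat \<Rightarrow> real)
     \<Rightarrow> nat \<Rightarrow> (nat \<Rightarrow> real) \<Rightarrow> (nat \<Rightarrow> real) \<Rightarrow> bool" where
  "birth_death_process \<Omega> Z P K birth death \<longleftrightarrow>
     markov_process \<Omega> Z {0..K} P \<and>
     has_rates {0..K} P (birth_death_generator birth death)"

definition stationary_distribution ::
  "nat set \<Rightarrow> (real \<Rightarrow> nat \<Rightarrow> nat \<Rightarrow> real) \<Rightarrow> (nat \<Rightarrow> real) \<Rightarrow> bool" where
  "stationary_distribution S P q \<longleftrightarrow>
     (\<forall>z\<in>S. 0 \<le> q z) \<and> (\<Sum>z\<in>S. q z) = 1 \<and>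
     (\<forall>t\<ge>0. \<forall>z\<in>S. (\<Sum>y\<in>S. q y * P t y z) = q z)"

definition coeff_below :: "real \<Rightarrow> real \<Rightarrow> nat \<Rightarrow> nat \<Rightarrow> nat \<Rightarrow> real" where
  "coeff_below \<mu> \<nu> M K z =
     (\<mu> / \<nu>) ^ (M - z) * ((\<Prod>j\<in>{0..<M - z}. real M - real j)
                          / (\<Prod>j\<in>{1..M - z}. real K - real M + real j))"

definition coeff_above :: "real \<Rightarrow> real \<Rightarrow> nat \<Rightarrow> nat \<Rightarrow> nat \<Rightarrow> real" where
  "coeff_above \<mu> \<nu> M K z =
     1 / real M ^ (z - M) * (\<nu> / \<mu>) ^ (z - M)
       * (\<Prod>j\<in>{0..<z - M}. real K - real M - real j)"

definition pi_f_M :: "real \<Rightarrow> real \<Rightarrow> nat \<Rightarrow> nat \<Rightarrow> real" where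
  "pi_f_M \<mu> \<nu> M K =
     inverse ((\<Sum>l\<in>{0..<M}. coeff_below \<mu> \<nu> M K l) + (\<Sum>l\<in>{M..K}. coeff_above \<mu> \<nu> M K l))"

text \<open>For \<open>z = M\<close> the second branch has coefficient 1, so \<open>pi_f_M\<close> is indeed the value at \<open>M\<close>.\<close>

definition pi_f :: "real \<Rightarrow> real \<Rightarrow> nat \<Rightarrow> nat \<Rightarrow> nat \<Rightarrow> real" where
  "pi_f \<mu> \<nu> M K z =
     (if z < M then coeff_below \<mu> \<nu> M K z * pi_f_M \<mu> \<nu> M K
      else coeff_above \<mu> \<nu> M K z * pi_f_M \<mu> \<nu> M K)"

end

theory Submission imports Defs begin

text \<open>
  Stationarity of \<open>pi_f\<close> for the whole semigroup, its uniqueness and the convergence of the law all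
  come out of one ergodic argument, without solving Kolmogorov's differential equations.

  Since neighbouring states communicate at positive rate, some \<open>P t\<^sub>0\<close> has only positive entries
  (\<open>birth_death_transition_function_positive\<close>). By Doeblin's contraction argument every column of
  \<open>P t\<close> then converges to a constant (\<open>positive_transition_function_converges\<close>), and the vector \<open>p\<close>
  of these constants is a stationary distribution (\<open>limit_of_transition_function_stationary\<close>).

  Any stationary distribution is annihilated by the generator
  (\<open>stationary_distribution_annihilates_generator\<close>). For a birth-death generator this forces detailed
  balance \<open>q z * birth z = q (z + 1) * death (z + 1)\<close> (\<open>birth_death_detailed_balance\<close>), a first-order
  recursion that determines \<open>q\<close> up to a factor; normalisation fixes the factor, and the result is
  \<open>pi_f\<close> (\<open>parking_lot_detailed_balance_unique\<close>). So there is at most one stationary distribution,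
  and as \<open>p\<close> is one, \<open>p\<close> equals \<open>pi_f\<close> on \<open>{0..K}\<close>. Finally, the law at time \<open>t\<close> is a mixture of the
  rows of \<open>P t\<close>, each of which tends to \<open>p\<close>.
\<close>

section \<open>Convergence of a strictly positive finite Markov semigroup\<close>

text \<open>
  The entry at \<open>a\<close> falls short of \<open>hi\<close> by \<open>hi - f a\<close> and carries weight at least \<open>\<delta>\<close>, so the mean
  falls short of \<open>hi\<close> by at least \<open>\<delta> * (hi - f a)\<close>.
\<close>

lemma weighted_mean_below_upper_bound:
  fixes w f :: "'a \<Rightarrow> real"
  assumes S: "finite S" "a \<in> S" and w: "\<And>k. k \<in> S \<Longrightarrow> 0 \<le> w k" "(\<Sum>k\<in>S. w k) = 1"
    and \<delta>: "\<delta> \<le> w a" and hi: "\<And>k. k \<in> S \<Longrightarrow> f k \<le> hi"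
  shows "(\<Sum>k\<in>S. w k * f k) \<le> hi - \<delta> * (hi - f a)"
proof -
  have "\<delta> * (hi - f a) \<le> w a * (hi - f a)"
    using \<delta> hi[OF S(2)] by (intro mult_right_mono) auto
  also have "\<dots> \<le> (\<Sum>k\<in>S. w k * (hi - f k))"
    using S w hi by (intro member_le_sum) auto
  also have "\<dots> = hi - (\<Sum>k\<in>S. w k * f k)"
    using w(2) by (simp add: right_diff_distrib sum_subtractf flip: sum_distrib_right)
  finally show ?thesis by simp
qed

lemma weighted_mean_between:
  fixes w f :: "'a \<Rightarrow> real"
  assumes S: "finite S" "S \<noteq> {}" and w: "\<And>k. k \<in> S \<Longrightarrow> 0 \<le> w k" "(\<Sum>k\<in>S. w k) = 1"
    and f: "\<And>k. k \<in> S \<Longrightarrow> lo \<le> f k \<and> f k \<le> hi"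
  shows "lo \<le> (\<Sum>k\<in>S. w k * f k)" "(\<Sum>k\<in>S. w k * f k) \<le> hi"
proof -
  obtain a where a: "a \<in> S" using S(2) by blast
  show "(\<Sum>k\<in>S. w k * f k) \<le> hi"
    using weighted_mean_below_upper_bound[OF S(1) a w, of 0 f hi] w(1)[OF a] f by auto
  show "lo \<le> (\<Sum>k\<in>S. w k * f k)"
    using weighted_mean_below_upper_bound[OF S(1) a w, of 0 "\<lambda>k. - f k" "- lo"] w(1)[OF a] f
    by (auto simp: sum_negf)
qed

lemma transition_function_nonneg:
  "transition_function S P \<Longrightarrow> 0 \<le> t \<Longrightarrow> i \<in> S \<Longrightarrow> j \<in> S \<Longrightarrow> 0 \<le> P t i j"
  and transition_function_sum:
  "transition_function S P \<Longrightarrow> 0 \<le> t \<Longrightarrow> i \<in> S \<Longrightarrow> (\<Sum>j\<in>S. P t i j) = 1"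
  and transition_function_zero:
  "transition_function S P \<Longrightarrow> i \<in> S \<Longrightarrow> j \<in> S \<Longrightarrow> P 0 i j = (if i = j then 1 else 0)"
  and Chapman_Kolmogorov:
  "transition_function S P \<Longrightarrow> 0 \<le> s \<Longrightarrow> 0 \<le> t \<Longrightarrow> i \<in> S \<Longrightarrow> j \<in> S \<Longrightarrow>
     P (s + t) i j = (\<Sum>k\<in>S. P s i k * P t k j)"
  unfolding transition_function_def by auto

text \<open>
  Doeblin's argument. A step of the semigroup replaces the column \<open>P t \<cdot> j\<close> by weighted means of
  its entries, so its maximum decreases and its minimum increases with \<open>t\<close>. Over a time \<open>t\<^sub>0\<close> every
  weight is at least some \<open>\<delta> > 0\<close>; in particular the minimal entry gets weight \<open>\<delta>\<close>, which pulls
  the maximum down by \<open>\<delta>\<close> times the oscillation. Hence the oscillation decays geometrically and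
  the column converges to a constant.
\<close>

lemma positive_transition_function_converges:
  assumes P: "transition_function S P" and S: "finite S" "S \<noteq> {}"
    and t\<^sub>0: "0 \<le> t\<^sub>0" "\<And>i j. i \<in> S \<Longrightarrow> j \<in> S \<Longrightarrow> 0 < P t\<^sub>0 i j"
  obtains q where "\<And>i j. i \<in> S \<Longrightarrow> j \<in> S \<Longrightarrow> ((\<lambda>t. P t i j) \<longlongrightarrow> q j) at_top"
proof -
  note nonneg = transition_function_nonneg[OF P] and sum1 = transition_function_sum[OF P]
  define \<delta> where "\<delta> = Min ((\<lambda>(i, j). P t\<^sub>0 i j) ` (S \<times> S))"
  have \<delta>_pos: "0 < \<delta>"
    unfolding \<delta>_def using S t\<^sub>0(2) by (subst Min_gr_iff) auto
  have \<delta>_le: "\<delta> \<le> P t\<^sub>0 i j" if "i \<in> S" "j \<in> S" for i j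
    unfolding \<delta>_def using S that by (intro Min_le) (auto intro: image_eqI[where x = "(i, j)"])
  have \<delta>_le1: "\<delta> \<le> 1"
  proof -
    obtain i where i: "i \<in> S" using S(2) by blast
    have "\<delta> \<le> P t\<^sub>0 i i" by (rule \<delta>_le[OF i i])
    also have "\<dots> \<le> (\<Sum>j\<in>S. P t\<^sub>0 i j)"
      using S i nonneg[OF t\<^sub>0(1)] by (intro member_le_sum) auto
    finally show ?thesis using sum1[OF t\<^sub>0(1) i] by simp
  qed
  have "\<exists>L. \<forall>i\<in>S. ((\<lambda>t. P t i j) \<longlongrightarrow> L) at_top" if j: "j \<in> S" for j
  proof -
    define hi where "hi t = Max ((\<lambda>i. P t i j) ` S)" for t
    define lo where "lo t = Min ((\<lambda>i. P t i j) ` S)" for t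
    have le_hi: "P t i j \<le> hi t" and lo_le: "lo t \<le> P t i j" if "i \<in> S" for t i
      unfolding hi_def lo_def using S that by auto
    have hi_leI: "hi t \<le> c" if "\<And>i. i \<in> S \<Longrightarrow> P t i j \<le> c" for t c
      unfolding hi_def using S that by (subst Max_le_iff) auto
    have lo_geI: "c \<le> lo t" if "\<And>i. i \<in> S \<Longrightarrow> c \<le> P t i j" for t c
      unfolding lo_def using S that by (subst Min_ge_iff) auto
    have lo_le_hi: "lo t \<le> hi t" for t
      using S(2) le_hi lo_le by (meson all_not_in_conv order_trans)
    have step: "lo t \<le> P (s + t) i j" "P (s + t) i j \<le> hi t" if "0 \<le> s" "0 \<le> t" "i \<in> S" for s t i
      using weighted_mean_between[OF S, of "P s i" "lo t" "\<lambda>k. P t k j" "hi t"]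
        nonneg[OF that(1,3)] sum1[OF that(1,3)] le_hi lo_le Chapman_Kolmogorov[OF P that j]
      by auto
    have mono: "lo t \<le> lo s" "hi s \<le> hi t" if "0 \<le> t" "t \<le> s" for s t
      using step[of "s - t" t] that by (auto intro!: lo_geI hi_leI)
    have contract: "hi (t\<^sub>0 + t) - lo (t\<^sub>0 + t) \<le> (1 - \<delta>) * (hi t - lo t)" if t: "0 \<le> t" for t
    proof -
      have "lo t \<in> (\<lambda>i. P t i j) ` S"
        unfolding lo_def using S by (intro Min_in) auto
      then obtain a where a: "a \<in> S" "P t a j = lo t" by auto
      have "hi (t\<^sub>0 + t) \<le> hi t - \<delta> * (hi t - lo t)"
        using weighted_mean_below_upper_bound[OF S(1) a(1), of "P t\<^sub>0 _" \<delta> "\<lambda>k. P t k j" "hi t"]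
          nonneg[OF t\<^sub>0(1)] sum1[OF t\<^sub>0(1)] \<delta>_le a le_hi
        by (intro hi_leI) (simp add: Chapman_Kolmogorov[OF P t\<^sub>0(1) t _ j])
      moreover have "lo t \<le> lo (t\<^sub>0 + t)" using t t\<^sub>0(1) by (intro mono) auto
      ultimately show ?thesis by (simp add: algebra_simps)
    qed
    have geometric: "hi (real n * t\<^sub>0) - lo (real n * t\<^sub>0) \<le> (1 - \<delta>) ^ n * (hi 0 - lo 0)" for n
    proof (induction n)
      case (Suc n)
      have "hi (t\<^sub>0 + real n * t\<^sub>0) - lo (t\<^sub>0 + real n * t\<^sub>0)
          \<le> (1 - \<delta>) * (hi (real n * t\<^sub>0) - lo (real n * t\<^sub>0))"
        using t\<^sub>0(1) by (intro contract) simp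
      also have "\<dots> \<le> (1 - \<delta>) * ((1 - \<delta>) ^ n * (hi 0 - lo 0))"
        using Suc \<delta>_le1 by (intro mult_left_mono) auto
      finally show ?case by (simp add: algebra_simps)
    qed simp
    (* The intervals [lo t, hi t] are nested, so the supremum of their left ends lies in all of them. *)
    define L where "L = (SUP t\<in>{0..}. lo t)"
    have "lo s \<le> hi t" if "0 \<le> s" "0 \<le> t" for s t
      using mono(1)[of s "max s t"] mono(2)[of t "max s t"] lo_le_hi[of "max s t"] that by linarith
    then have L: "lo t \<le> L" "L \<le> hi t" if "0 \<le> t" for t
      unfolding L_def using that
      by (auto intro!: cSUP_upper cSUP_least bdd_aboveI2[where M = "hi t"])
    have "((\<lambda>t. P t i j) \<longlongrightarrow> L) at_top" if i: "i \<in> S" for i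
    proof (rule tendstoI)
      fix e :: real assume e: "0 < e"
      have "(\<lambda>n. (1 - \<delta>) ^ n * (hi 0 - lo 0)) \<longlonglongrightarrow> 0 * (hi 0 - lo 0)"
        using \<delta>_pos \<delta>_le1 by (intro tendsto_intros LIMSEQ_power_zero) auto
      then have "\<forall>\<^sub>F n in sequentially. (1 - \<delta>) ^ n * (hi 0 - lo 0) < e"
        using e by (intro order_tendstoD(2)) auto
      then obtain n where n: "(1 - \<delta>) ^ n * (hi 0 - lo 0) < e"
        using eventually_happens'[OF sequentially_bot] by blast
      define T where "T = real n * t\<^sub>0"
      have T: "0 \<le> T" "hi T - lo T < e"
        using t\<^sub>0(1) n geometric[of n] by (auto simp: T_def)
      show "\<forall>\<^sub>F t in at_top. dist (P t i j) L < e"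
        using eventually_ge_at_top[of T]
      proof eventually_elim
        case (elim t)
        then show ?case
          using step[of "t - T" T i] L[OF T(1)] T i by (simp add: dist_real_def)
      qed
    qed
    then show ?thesis by blast
  qed
  then show thesis using that by metis
qed

text \<open>
  Letting \<open>s \<longlongrightarrow> \<infinity>\<close> in the Chapman-Kolmogorov equation for \<open>P (s + t)\<close> shows that the limit of a row
  is invariant under every \<open>P t\<close>.
\<close>

lemma limit_of_transition_function_stationary:
  assumes P: "transition_function S P" and S: "finite S" "i \<in> S"
    and q: "\<And>j. j \<in> S \<Longrightarrow> ((\<lambda>t. P t i j) \<longlongrightarrow> q j) at_top"
  shows "stationary_distribution S P q"
  unfolding stationary_distribution_def
proof (intro conjI ballI allI impI)
  fix z assume z: "z \<in> S"
  show "0 \<le> q z"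
    using q[OF z] by (rule tendsto_lowerbound)
      (auto intro!: eventually_at_top_linorderI[of 0] transition_function_nonneg[OF P] S z)
next
  have "((\<lambda>t. \<Sum>j\<in>S. P t i j) \<longlongrightarrow> (\<Sum>j\<in>S. q j)) at_top"
    using q by (intro tendsto_sum)
  moreover have "((\<lambda>t. \<Sum>j\<in>S. P t i j) \<longlongrightarrow> 1) at_top"
    by (rule tendsto_eventually)
      (auto intro!: eventually_at_top_linorderI[of 0] transition_function_sum[OF P] S)
  ultimately show "(\<Sum>z\<in>S. q z) = 1"
    using tendsto_unique[OF trivial_limit_at_top_linorder] by blast
next
  fix t :: real and z assume t: "0 \<le> t" and z: "z \<in> S"
  have "((\<lambda>s. \<Sum>y\<in>S. P s i y * P t y z) \<longlongrightarrow> (\<Sum>y\<in>S. q y * P t y z)) at_top"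
    using q by (intro tendsto_intros)
  moreover have "((\<lambda>s. \<Sum>y\<in>S. P s i y * P t y z) \<longlongrightarrow> q z) at_top"
  proof (rule Lim_transform_eventually)
    show "((\<lambda>s. P (s + t) i z) \<longlongrightarrow> q z) at_top"
      using q[OF z] by (rule filterlim_compose)
        (simp add: filterlim_tendsto_add_at_top[OF tendsto_const filterlim_ident] add.commute[of _ t])
    show "\<forall>\<^sub>F s in at_top. P (s + t) i z = (\<Sum>y\<in>S. P s i y * P t y z)"
      using Chapman_Kolmogorov[OF P _ t S(2) z] by (auto intro!: eventually_at_top_linorderI[of 0])
  qed
  ultimately show "(\<Sum>y\<in>S. q y * P t y z) = q z"
    using tendsto_unique[OF trivial_limit_at_top_linorder] by blast
qed

section \<open>Birth-death processes\<close>

text \<open>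
  Differentiating the constant function \<open>t \<mapsto> (q P\<^sub>t) z\<close> at \<open>0\<close>.
\<close>

lemma stationary_distribution_annihilates_generator:
  assumes Q: "has_rates S P Q" and q: "stationary_distribution S P q" and z: "z \<in> S"
  shows "(\<Sum>y\<in>S. q y * Q y z) = 0"
proof -
  have "((\<lambda>t. \<Sum>y\<in>S. q y * P t y z) has_real_derivative (\<Sum>y\<in>S. q y * Q y z)) (at 0 within {0..})"
    using Q z unfolding has_rates_def by (intro DERIV_sum DERIV_cmult) auto
  moreover have "((\<lambda>t. \<Sum>y\<in>S. q y * P t y z) has_real_derivative 0) (at 0 within {0..})"
    using q z unfolding stationary_distribution_def
    by (intro has_field_derivative_transform_within[OF DERIV_const[of "q z"] zero_less_one]) auto
  moreover have "at (0 :: real) within {0..} \<noteq> bot"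
    by (simp add: at_within_Ici_at_right)
  ultimately show ?thesis
    using has_field_derivative_unique by blast
qed

lemma sum_birth_death_generator:
  assumes "z < K"
  shows "(\<Sum>y\<in>{0..K}. q y * birth_death_generator birth death y z)
    = (if z = 0 then 0 else q (z - 1) * birth (z - 1)) - q z * (birth z + death z)
      + q (z + 1) * death (z + 1)"
proof -
  have "(\<Sum>y\<in>{0..K}. q y * birth_death_generator birth death y z)
      = (\<Sum>y\<in>(if z = 0 then {0, 1} else {z - 1, z, z + 1}). q y * birth_death_generator birth death y z)"
    using assms by (intro sum.mono_neutral_right) (auto simp: birth_death_generator_def)
  then show ?thesis
    by (cases z) (simp_all add: birth_death_generator_def algebra_simps)
qed

text \<open>
  The net flow across each edge \<open>{z, z + 1}\<close> vanishes: by the balance equation in \<open>z\<close> it equals the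
  net flow across the edge below, and there is no edge below \<open>0\<close>.
\<close>

lemma birth_death_detailed_balance:
  assumes balance: "\<And>z. z \<le> K \<Longrightarrow> (\<Sum>y\<in>{0..K}. q y * birth_death_generator birth death y z) = 0"
    and "death 0 = 0" "z < K"
  shows "q z * birth z = q (z + 1) * death (z + 1)"
  using \<open>z < K\<close>
proof (induction z)
  case 0
  then show ?case
    using balance[of 0] \<open>death 0 = 0\<close> by (simp add: sum_birth_death_generator)
next
  case (Suc z)
  then show ?case
    using balance[of "Suc z"] by (simp add: sum_birth_death_generator algebra_simps)
qed

text \<open>
  As the death rates do not vanish, detailed balance determines \<open>q (z + 1)\<close> from \<open>q z\<close>.
\<close>

lemma detailed_balance_solutions_proportional:
  fixes q c birth death :: "nat \<Rightarrow> real"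
  assumes q: "\<And>z. z < K \<Longrightarrow> q z * birth z = q (z + 1) * death (z + 1)"
    and c: "\<And>z. z < K \<Longrightarrow> c z * birth z = c (z + 1) * death (z + 1)"
    and death: "\<And>z. 0 < z \<Longrightarrow> z \<le> K \<Longrightarrow> death z \<noteq> 0"
    and "c 0 \<noteq> 0" "z \<le> K"
  shows "q z = q 0 / c 0 * c z"
  using \<open>z \<le> K\<close>
proof (induction z)
  case 0
  then show ?case using \<open>c 0 \<noteq> 0\<close> by simp
next
  case (Suc z)
  have "q (z + 1) * death (z + 1) = q 0 / c 0 * (c z * birth z)"
    using q[of z] Suc by simp
  also have "\<dots> = q 0 / c 0 * c (z + 1) * death (z + 1)"
    using c[of z] Suc by simp
  finally show ?case using death[of "z + 1"] Suc.prems by (simp del: times_divide_eq_left times_divide_eq_right)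
qed

text \<open>
  Over a short time \<open>h\<close> the process can stay where it is or move to a neighbour, with positive
  probability; in \<open>K\<close> such steps it can reach every state from every other.
\<close>

lemma birth_death_transition_function_positive:
  assumes P: "transition_function {0..K} P"
    and Q: "has_rates {0..K} P (birth_death_generator birth death)"
    and birth: "\<And>z. z < K \<Longrightarrow> 0 < birth z" and death: "\<And>z. 0 < z \<Longrightarrow> z \<le> K \<Longrightarrow> 0 < death z"
  obtains t\<^sub>0 where "0 \<le> t\<^sub>0" "\<And>i j. i \<le> K \<Longrightarrow> j \<le> K \<Longrightarrow> 0 < P t\<^sub>0 i j"
proof -
  have deriv: "((\<lambda>t. P t i j) has_real_derivative birth_death_generator birth death i j) (at_right 0)"
    if "i \<le> K" "j \<le> K" for i j
    using Q that unfolding has_rates_def by (auto simp: at_within_Ici_at_right)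
  have "\<forall>\<^sub>F h in at_right 0. i \<le> j + 1 \<longrightarrow> j \<le> i + 1 \<longrightarrow> 0 < P h i j" if ij: "i \<le> K" "j \<le> K" for i j
  proof -
    consider "i = j" | "i = j + 1 \<or> j = i + 1" | "\<not> i \<le> j + 1 \<or> \<not> j \<le> i + 1" by linarith
    then show ?thesis
    proof cases
      case 1
      have "((\<lambda>t. P t i j) \<longlongrightarrow> P 0 i j) (at_right 0)"
        using DERIV_continuous[OF deriv[OF ij]] by (simp add: continuous_within)
      moreover have "P 0 i j = 1"
        using transition_function_zero[OF P] ij 1 by simp
      ultimately have "\<forall>\<^sub>F h in at_right 0. 0 < P h i j"
        by (intro order_tendstoD(1)) auto
      then show ?thesis by eventually_elim simp
    next
      case 2
      then have "0 < birth_death_generator birth death i j"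
        using birth[of i] death[of i] ij by (auto simp: birth_death_generator_def)
      from has_real_derivative_pos_inc_right[OF deriv[OF ij] this]
      obtain d where d: "0 < d" "\<And>h. 0 < h \<Longrightarrow> h < d \<Longrightarrow> P 0 i j < P h i j" by auto
      have "P 0 i j = 0"
        using transition_function_zero[OF P] ij 2 by auto
      then show ?thesis
        unfolding eventually_at_right_field using d by auto
    next
      case 3
      then show ?thesis by (intro always_eventually) auto
    qed
  qed
  then have "\<forall>\<^sub>F h in at_right 0. 0 < h \<and>
      (\<forall>i\<in>{0..K}. \<forall>j\<in>{0..K}. i \<le> j + 1 \<longrightarrow> j \<le> i + 1 \<longrightarrow> 0 < P h i j)"
    by (intro eventually_conj eventually_at_right_less eventually_ball_finite ballI) auto
  from eventually_happens'[OF trivial_limit_at_right_real this]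
  obtain h where h: "0 < h"
    and near_ball: "\<forall>i\<in>{0..K}. \<forall>j\<in>{0..K}. i \<le> j + 1 \<longrightarrow> j \<le> i + 1 \<longrightarrow> 0 < P h i j"
    by blast
  have near: "0 < P h i j" if "i \<le> K" "j \<le> K" "i \<le> j + 1" "j \<le> i + 1" for i j
    using near_ball that by simp
  have reach: "0 < P (real n * h) i j" if "i \<le> K" "j \<le> K" "i \<le> j + n" "j \<le> i + n" for n i j
    using that
  proof (induction n arbitrary: j)
    case 0
    then show ?case using transition_function_zero[OF P, of i j] by simp
  next
    case (Suc n)
    (* k is the state before the last step of a path from i to j. *)
    define k where "k = (if i = j then j else if i < j then j - 1 else j + 1)"
    have k: "k \<le> K" "i \<le> k + n" "k \<le> i + n" "k \<le> j + 1" "j \<le> k + 1"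
      using Suc.prems by (auto simp: k_def)
    have nh: "0 \<le> real n * h" using h by simp
    have "0 < P (real n * h) i k * P h k j"
      using Suc.IH[of k] near[of k j] Suc.prems k by simp
    then have "0 < (\<Sum>k\<in>{0..K}. P (real n * h) i k * P h k j)"
      using k Suc.prems h transition_function_nonneg[OF P nh] transition_function_nonneg[OF P, of h]
      by (intro sum_pos2[where i = k]) auto
    also have "\<dots> = P (real n * h + h) i j"
      using Chapman_Kolmogorov[OF P nh, of h i j] h Suc.prems by simp
    finally show ?case by (simp add: algebra_simps)
  qed
  show thesis
    using that[of "real K * h"] reach[of _ _ K] h by auto
qed

section \<open>The law of the process\<close>

lemma markov_process_law:
  assumes Z: "markov_process \<Omega> Z S P" and S: "finite S" "z \<in> S" and t: "0 < t"
  shows "measure \<Omega> {\<omega> \<in> space \<Omega>. Z t \<omega> = z}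
    = (\<Sum>y\<in>S. measure \<Omega> {\<omega> \<in> space \<Omega>. Z 0 \<omega> = y} * P t y z)"
    (is "_ = ?R")
proof -
  interpret prob_space \<Omega> using Z unfolding markov_process_def by blast
  have meas: "Z s \<in> measurable \<Omega> (count_space S)" if "0 \<le> s" for s
    using Z that unfolding markov_process_def by blast
  have event: "{\<omega> \<in> space \<Omega>. Z s \<omega> = y} \<in> events" if "0 \<le> s" "y \<in> S" for s y
    using measurable_sets[OF meas[OF that(1)], of "{y}"] that
    by (simp add: vimage_def Int_def conj_commute)
  have markov_property: "prob {\<omega> \<in> space \<Omega>. \<forall>k\<le>Suc n. Z (s k) \<omega> = x k}
      = prob {\<omega> \<in> space \<Omega>. \<forall>k\<le>n. Z (s k) \<omega> = x k} * P (s (Suc n) - s n) (x n) (x (Suc n))"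
    if "0 \<le> s 0" "\<forall>k\<le>n. s k < s (Suc k)" "\<forall>k\<le>Suc n. x k \<in> S" for n s x
    using Z that unfolding markov_process_def by blast
  have joint: "prob {\<omega> \<in> space \<Omega>. Z 0 \<omega> = y \<and> Z t \<omega> = z}
      = prob {\<omega> \<in> space \<Omega>. Z 0 \<omega> = y} * P t y z" if y: "y \<in> S" for y
  proof -
    define s :: "nat \<Rightarrow> real" where "s k = real k * t" for k
    define x where "x k = (if k = 0 then y else z)" for k :: nat
    have "prob {\<omega> \<in> space \<Omega>. \<forall>k\<le>Suc 0. Z (s k) \<omega> = x k}
        = prob {\<omega> \<in> space \<Omega>. \<forall>k\<le>0. Z (s k) \<omega> = x k} * P (s (Suc 0) - s 0) (x 0) (x (Suc 0))"
    proof (rule markov_property)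
      show "0 \<le> s 0" "\<forall>k\<le>0. s k < s (Suc k)" "\<forall>k\<le>Suc 0. x k \<in> S"
        using t y S(2) by (auto simp: s_def x_def)
    qed
    then show ?thesis by (simp add: s_def x_def le_Suc_eq all_conj_distrib conj_commute)
  qed
  have "{\<omega> \<in> space \<Omega>. Z t \<omega> = z} = (\<Union>y\<in>S. {\<omega> \<in> space \<Omega>. Z 0 \<omega> = y \<and> Z t \<omega> = z})"
    using measurable_space[OF meas[of 0]] by auto
  moreover have "{\<omega> \<in> space \<Omega>. Z 0 \<omega> = y \<and> Z t \<omega> = z} \<in> events" if "y \<in> S" for y
    using event[of 0 y] event[of t z] that t S(2) by (intro sets.sets_Collect_conj) auto
  ultimately have "prob {\<omega> \<in> space \<Omega>. Z t \<omega> = z}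
      = (\<Sum>y\<in>S. prob {\<omega> \<in> space \<Omega>. Z 0 \<omega> = y \<and> Z t \<omega> = z})"
    using S(1) by (simp, subst finite_measure_finite_Union) (auto simp: disjoint_family_on_def)
  also have "\<dots> = ?R" using joint by simp
  finally show ?thesis .
qed

lemma markov_process_initial_law_sum:
  assumes Z: "markov_process \<Omega> Z S P" and S: "finite S"
  shows "(\<Sum>y\<in>S. measure \<Omega> {\<omega> \<in> space \<Omega>. Z 0 \<omega> = y}) = 1"
proof -
  interpret prob_space \<Omega> using Z unfolding markov_process_def by blast
  have meas: "Z 0 \<in> measurable \<Omega> (count_space S)"
    using Z unfolding markov_process_def by blast
  have event: "{\<omega> \<in> space \<Omega>. Z 0 \<omega> = y} \<in> events" if "y \<in> S" for y
    using measurable_sets[OF meas, of "{y}"] that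
    by (simp add: vimage_def Int_def conj_commute)
  have "(\<Sum>y\<in>S. prob {\<omega> \<in> space \<Omega>. Z 0 \<omega> = y}) = prob (\<Union>y\<in>S. {\<omega> \<in> space \<Omega>. Z 0 \<omega> = y})"
    using S event by (subst finite_measure_finite_Union) (auto simp: disjoint_family_on_def)
  also have "(\<Union>y\<in>S. {\<omega> \<in> space \<Omega>. Z 0 \<omega> = y}) = space \<Omega>"
    using measurable_space[OF meas] by auto
  finally show ?thesis by (simp add: prob_space)
qed

text \<open>
  The initial probabilities sum to 1, so a column of \<open>P t\<close> that becomes constant hides where the
  process started.
\<close>

lemma markov_process_law_tendsto:
  assumes Z: "markov_process \<Omega> Z S P" and S: "finite S" "z \<in> S"
    and lim: "\<And>y. y \<in> S \<Longrightarrow> ((\<lambda>t. P t y z) \<longlongrightarrow> l) at_top"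
  shows "((\<lambda>t. measure \<Omega> {\<omega> \<in> space \<Omega>. Z t \<omega> = z}) \<longlongrightarrow> l) at_top"
proof (rule Lim_transform_eventually)
  let ?p = "\<lambda>y. measure \<Omega> {\<omega> \<in> space \<Omega>. Z 0 \<omega> = y}"
  have "((\<lambda>t. \<Sum>y\<in>S. ?p y * P t y z) \<longlongrightarrow> (\<Sum>y\<in>S. ?p y * l)) at_top"
    using lim by (intro tendsto_intros)
  then show "((\<lambda>t. \<Sum>y\<in>S. ?p y * P t y z) \<longlongrightarrow> l) at_top"
    using markov_process_initial_law_sum[OF Z S(1)] by (simp flip: sum_distrib_right)
  show "\<forall>\<^sub>F t in at_top. (\<Sum>y\<in>S. ?p y * P t y z) = measure \<Omega> {\<omega> \<in> space \<Omega>. Z t \<omega> = z}"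
    using eventually_gt_at_top[of 0] by eventually_elim (simp add: markov_process_law[OF Z S])
qed

section \<open>The full parking lot\<close>

lemma coeff_below_detailed_balance:
  assumes "z < M" "M \<le> K" "0 < \<nu>"
  shows "coeff_below \<mu> \<nu> M K z * (\<nu> * (real K - real z))
    = coeff_below \<mu> \<nu> M K (z + 1) * (\<mu> * real (z + 1))"
proof -
  define n where "n = M - (z + 1)"
  define num where "num = (\<Prod>j\<in>{0..<n}. real M - real j)"
  define den where "den = (\<Prod>j\<in>{1..n}. real K - real M + real j)"
  define d where "d = real K - real z"
  have n: "M - z = Suc n" "M - (z + 1) = n" and last: "real M - real n = real (z + 1)"
    "real K - real M + real (Suc n) = d"
    using assms by (auto simp: n_def d_def of_nat_diff)
  have "0 < den" "0 < d"
    using assms by (auto simp: den_def d_def intro!: prod_pos)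
  have "coeff_below \<mu> \<nu> M K z = (\<mu> / \<nu>) ^ Suc n * (num * real (z + 1) / (den * d))"
    unfolding coeff_below_def n num_def den_def last[symmetric] by simp
  moreover have "coeff_below \<mu> \<nu> M K (z + 1) = (\<mu> / \<nu>) ^ n * (num / den)"
    unfolding coeff_below_def n num_def den_def ..
  ultimately show ?thesis
    using \<open>0 < den\<close> \<open>0 < d\<close> assms(3) by (simp add: d_def[symmetric])
qed

lemma coeff_above_detailed_balance:
  assumes "M \<le> z" "0 < M" "0 < \<mu>"
  shows "coeff_above \<mu> \<nu> M K z * (\<nu> * (real K - real z))
    = coeff_above \<mu> \<nu> M K (z + 1) * (\<mu> * real M)"
  using assms unfolding coeff_above_def
  by (simp add: Suc_diff_le of_nat_diff field_simps)

lemma coeff_at_M: "coeff_below \<mu> \<nu> M K M = coeff_above \<mu> \<nu> M K M"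
  by (simp add: coeff_below_def coeff_above_def)

lemma coeff_below_pos:
  assumes "0 < \<mu>" "0 < \<nu>" "M \<le> K"
  shows "0 < coeff_below \<mu> \<nu> M K z"
  unfolding coeff_below_def using assms
  by (intro mult_pos_pos zero_less_power divide_pos_pos prod_pos) auto

text \<open>
  The coefficients solve the detailed balance equations for the given rates, and \<open>pi_f_M\<close> is the
  factor that normalises them.
\<close>

lemma parking_lot_detailed_balance_unique:
  assumes pos: "0 < \<mu>" "0 < \<nu>" "0 < M" "M \<le> K"
    and q: "\<And>z. z < K \<Longrightarrow> q z * (\<nu> * (real K - real z)) = q (z + 1) * (\<mu> * real (min (z + 1) M))"
    and sum_q: "(\<Sum>z\<in>{0..K}. q z) = 1" and z: "z \<le> K"
  shows "q z = pi_f \<mu> \<nu> M K z"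
proof -
  define c where "c z = (if z < M then coeff_below \<mu> \<nu> M K z else coeff_above \<mu> \<nu> M K z)" for z
  have c: "c z * (\<nu> * (real K - real z)) = c (z + 1) * (\<mu> * real (min (z + 1) M))" for z
  proof (cases "z < M")
    case True
    (* At z = M - 1 the two branches meet. *)
    then have "c (z + 1) = coeff_below \<mu> \<nu> M K (z + 1)"
      by (cases "z + 1 = M") (auto simp: c_def coeff_at_M)
    then show ?thesis
      using True coeff_below_detailed_balance[of z M K \<nu> \<mu>] pos by (simp add: c_def)
  next
    case False
    then show ?thesis
      using coeff_above_detailed_balance[of M z \<mu> \<nu> K] pos by (simp add: c_def)
  qed
  have c0: "c 0 \<noteq> 0" using coeff_below_pos[of \<mu> \<nu> M K 0] pos by (simp add: c_def)
  have q_eq: "q z = q 0 / c 0 * c z" if "z \<le> K" for z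
    using detailed_balance_solutions_proportional[OF q c _ c0 that] pos by simp
  have "{0..K} = {0..<M} \<union> {M..K}" using pos by auto
  then have "(\<Sum>z\<in>{0..K}. c z)
      = (\<Sum>z\<in>{0..<M}. coeff_below \<mu> \<nu> M K z) + (\<Sum>z\<in>{M..K}. coeff_above \<mu> \<nu> M K z)"
    by (subst \<open>{0..K} = _\<close>, subst sum.union_disjoint) (auto simp: c_def)
  moreover have "q 0 / c 0 * (\<Sum>z\<in>{0..K}. c z) = 1"
    unfolding sum_distrib_left sum_q[symmetric] by (intro sum.cong refl q_eq[symmetric]) simp
  ultimately have "q 0 / c 0 = pi_f_M \<mu> \<nu> M K"
    unfolding pi_f_M_def by (intro inverse_unique[symmetric]) (simp only: mult.commute)
  then show ?thesis
    using q_eq[OF z] by (simp add: pi_f_def c_def)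
qed

theorem proposition3p4:
  fixes \<mu> \<nu> :: real and M K :: nat
    and \<Omega> :: "'w measure" and Z\<^sub>f :: "real \<Rightarrow> 'w \<Rightarrow> nat"
    and P :: "real \<Rightarrow> nat \<Rightarrow> nat \<Rightarrow> real"
  assumes "\<mu> > 0" and "\<nu> > 0" and "M > 0" and "K > 0" and "M \<le> K"
    and "birth_death_process \<Omega> Z\<^sub>f P K
           (\<lambda>z. \<nu> * (real K - real z)) (\<lambda>z. \<mu> * real (min z M))"
  shows "(\<forall>q. stationary_distribution {0..K} P q \<longleftrightarrow> (\<forall>z\<in>{0..K}. q z = pi_f \<mu> \<nu> M K z)) \<and>
         (\<forall>z\<in>{0..K}. ((\<lambda>t. measure \<Omega> {\<omega> \<in> space \<Omega>. Z\<^sub>f t \<omega> = z}) \<longlongrightarrow> pi_f \<mu> \<nu> M K z) at_top)"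
proof -
  let ?birth = "\<lambda>z. \<nu> * (real K - real z)" and ?death = "\<lambda>z. \<mu> * real (min z M)"
  let ?S = "{0..K}"
  have Z: "markov_process \<Omega> Z\<^sub>f ?S P"
    and Q: "has_rates ?S P (birth_death_generator ?birth ?death)"
    and P: "transition_function ?S P"
    using assms(6) by (auto simp: birth_death_process_def markov_process_def)
  have unique: "q z = pi_f \<mu> \<nu> M K z" if q: "stationary_distribution ?S P q" and z: "z \<in> ?S" for q z
  proof (rule parking_lot_detailed_balance_unique[OF assms(1,2,3,5)])
    show "q z * ?birth z = q (z + 1) * ?death (z + 1)" if "z < K" for z
      by (rule birth_death_detailed_balance[OF _ _ that])
        (use stationary_distribution_annihilates_generator[OF Q q] in auto)
  qed (use q z in \<open>auto simp: stationary_distribution_def\<close>)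
  obtain t\<^sub>0 where t\<^sub>0: "0 \<le> t\<^sub>0" "\<And>i j. i \<le> K \<Longrightarrow> j \<le> K \<Longrightarrow> 0 < P t\<^sub>0 i j"
    using birth_death_transition_function_positive[OF P Q] assms(1-3) by auto
  obtain p where p: "\<And>i j. i \<in> ?S \<Longrightarrow> j \<in> ?S \<Longrightarrow> ((\<lambda>t. P t i j) \<longlongrightarrow> p j) at_top"
    using positive_transition_function_converges[OF P _ _ t\<^sub>0(1)] t\<^sub>0(2) by auto
  have p_stat: "stationary_distribution ?S P p"
    using limit_of_transition_function_stationary[OF P, of 0] p by simp
  note p_eq = unique[OF p_stat]
  (* Being a stationary distribution depends only on the values on {0..K}, where p and q agree. *)
  have "stationary_distribution ?S P q" if "\<forall>z\<in>?S. q z = pi_f \<mu> \<nu> M K z" for q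
    using p_stat that p_eq by (simp add: stationary_distribution_def)
  moreover have "((\<lambda>t. measure \<Omega> {\<omega> \<in> space \<Omega>. Z\<^sub>f t \<omega> = z}) \<longlongrightarrow> pi_f \<mu> \<nu> M K z) at_top"
    if "z \<in> ?S" for z
    using markov_process_law_tendsto[OF Z _ that] p that p_eq by simp
  ultimately show ?thesis using unique by blast
qed

end
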